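(* Let $n\geq 2$ be an integer and let $p,q$ be any two positive integers such that $n=p+q$. Then an ordered group $G$ embeds $1\oplus n$ if and only if it embeds $(q+1)\oplus p$.
   Context: Groups are written additively but are not assumed abelian. An ordered group $G=(X,+,\leq)$ is a group with a partial order $\leq$ compatible with the group operation, i.e. preserved by all left and right translations. For positive integers $r,s$, $r\oplus s$ denotes the poset which is the disjoint union of a chain with $r$ elements and a chain with $s$ elements, with every element of one chain incomparable to every element of the other. An ordered group $G$ embeds a poset $P$ if there is a one-to-one map $f$ from $P$ to $X$ such that $f(x)\leq f(y)$ if and only if $x\leq y$ for all $x,y\in P$. *)

theory Defs
  imports Main
begin

text \<open>
  The ordered groups of the library are all abelian, so the non-abelian notion is introduced here.
\<close>

class ordered_group_add = group_add + order +
  assumes add_left_mono_group: "a \<le> b \<Longrightarrow> c + a \<le> c + b"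
    and add_right_mono_group: "a \<le> b \<Longrightarrow> a + c \<le> b + c"

text \<open>
  As in \<^theory>\<open>HOL.Order_Relation\<close>, a poset is represented by its reflexive order relation,
  whose field is the carrier. In \<open>chain_sum r s\<close> the carrier consists of the \<open>Inl i\<close> with
  \<open>i < r\<close> and the \<open>Inr j\<close> with \<open>j < s\<close>.
\<close>

definition chain_sum :: "nat \<Rightarrow> nat \<Rightarrow> (nat + nat) rel" where
  "chain_sum r s =
     {(Inl i, Inl j) | i j. i \<le> j \<and> j < r} \<union> {(Inr i, Inr j) | i j. i \<le> j \<and> j < s}"

definition embeds_poset :: "'a::order itself \<Rightarrow> 'p rel \<Rightarrow> bool" where
  "embeds_poset _ P \<longleftrightarrow>
     (\<exists>f :: 'p \<Rightarrow> 'a. inj_on f (Field P) \<and>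
        (\<forall>x\<in>Field P. \<forall>y\<in>Field P. f x \<le> f y \<longleftrightarrow> (x, y) \<in> P))"

lemma Field_chain_sum: "Field (chain_sum r s) = {..<r} <+> {..<s}"
  by (auto simp: chain_sum_def Field_def Domain_iff Range_iff Plus_def image_iff)

lemma partial_order_on_chain_sum: "partial_order_on (Field (chain_sum r s)) (chain_sum r s)"
  unfolding partial_order_on_def preorder_on_def Field_chain_sum
  by (auto simp: chain_sum_def refl_on_def trans_def antisym_def)

end

theory Submission
  imports Defs
begin

text \<open>
  Whether two chains \<open>a\<^sub>0 < \<dots> < a\<^sub>r\<close> and \<open>b\<^sub>0 < \<dots> < b\<^sub>s\<close> are incomparable depends only on the
  differences \<open>a\<^sub>0 - b\<^sub>s\<close>, which must not be \<open>\<le> 0\<close>, and \<open>a\<^sub>r - b\<^sub>0\<close>, which must not be \<open>\<ge> 0\<close>.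
  Lowering the subtrahend from \<open>b\<^sub>s\<close> to \<open>b\<^sub>0\<close> and then raising the minuend from \<open>a\<^sub>0\<close> to \<open>a\<^sub>r\<close>
  joins these two differences by a chain of \<open>r + s + 1\<close> elements. Conversely, every chain
  \<open>y\<^sub>0 < \<dots> < y\<^bsub>r+s\<^esub>\<close> with \<open>y\<^sub>0\<close> not \<open>\<le> 0\<close> and \<open>y\<^bsub>r+s\<^esub>\<close> not \<open>\<ge> 0\<close> is of this form: put \<open>b\<^sub>0 = 0\<close>,
  so that the upper part of the chain is \<open>a\<close>, and solve \<open>y\<^sub>k = a\<^sub>0 - b\<^bsub>s-k\<^esub>\<close> for \<open>b\<close>. Hence embedding
  \<open>(r + 1) \<oplus> (s + 1)\<close> is a condition on the sum \<open>r + s\<close> alone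
  (lemma \<open>embeds_chain_sum_iff_chain\<close>), and \<open>1 \<oplus> n\<close> and \<open>(q + 1) \<oplus> p\<close> have the same sum.
\<close>

context ordered_group_add
begin

lemma group_add_strict_left_mono: "a < b \<Longrightarrow> c + a < c + b"
  by (simp add: order.strict_iff_order add_left_mono_group)

lemma group_add_strict_right_mono: "a < b \<Longrightarrow> a + c < b + c"
  by (simp add: order.strict_iff_order add_right_mono_group)

lemma group_diff_strict_right_mono: "a < b \<Longrightarrow> a - c < b - c"
  using group_add_strict_right_mono[of a b "- c"] by simp

lemma group_minus_strict_antimono:
  assumes "a < b"
  shows "- b < - a"
proof -
  have "- b + a + - a < - b + b + - a"
    using assms by (intro group_add_strict_right_mono group_add_strict_left_mono)
  then show ?thesis by (simp add: add.assoc)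
qed

lemma group_diff_strict_left_antimono: "a < b \<Longrightarrow> c - b < c - a"
  using group_add_strict_left_mono[OF group_minus_strict_antimono, of a b c] by simp

lemma group_diff_le_0_iff: "a - b \<le> 0 \<longleftrightarrow> a \<le> b"
  using add_right_mono_group[of a b "- b"] add_right_mono_group[of "a - b" 0 b] by auto

lemma group_0_le_diff_iff: "0 \<le> a - b \<longleftrightarrow> b \<le> a"
  using add_right_mono_group[of b a "- b"] add_right_mono_group[of 0 "a - b" b] by auto

end

text \<open>
  Since \<open>a\<^sub>i \<le> b\<^sub>j\<close> implies \<open>a\<^sub>0 \<le> b\<^sub>s\<close>, and symmetrically, the two extreme pairs decide whether
  the chains are incomparable. The lengths are successors so that the extremes exist.
\<close>

lemma embeds_chain_sum_iff_extremes:
  "embeds_poset TYPE('a::order) (chain_sum (Suc r) (Suc s)) \<longleftrightarrow>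
    (\<exists>a b :: nat \<Rightarrow> 'a. strict_mono_on {..r} a \<and> strict_mono_on {..s} b \<and>
       \<not> a 0 \<le> b s \<and> \<not> b 0 \<le> a r)"
    (is "?L \<longleftrightarrow> ?R")
proof
  assume ?L
  then obtain f :: "nat + nat \<Rightarrow> 'a"
    where f: "\<And>x y. x \<in> {..<Suc r} <+> {..<Suc s} \<Longrightarrow> y \<in> {..<Suc r} <+> {..<Suc s} \<Longrightarrow>
                f x \<le> f y \<longleftrightarrow> (x, y) \<in> chain_sum (Suc r) (Suc s)"
    unfolding embeds_poset_def Field_chain_sum by blast
  have "f (Inl i) \<le> f (Inl j) \<longleftrightarrow> i \<le> j" if "i \<le> r" "j \<le> r" for i j
    using that by (simp add: f InlI InrI less_Suc_eq_le chain_sum_def)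
  then have "strict_mono_on {..r} (\<lambda>i. f (Inl i))"
    by (intro strict_mono_onI) (simp add: less_le_not_le[where ?'a = 'a])
  moreover have "f (Inr i) \<le> f (Inr j) \<longleftrightarrow> i \<le> j" if "i \<le> s" "j \<le> s" for i j
    using that by (simp add: f InlI InrI less_Suc_eq_le chain_sum_def)
  then have "strict_mono_on {..s} (\<lambda>j. f (Inr j))"
    by (intro strict_mono_onI) (simp add: less_le_not_le[where ?'a = 'a])
  moreover have "\<not> f (Inl 0) \<le> f (Inr s)" "\<not> f (Inr 0) \<le> f (Inl r)"
    by (simp_all add: f InlI InrI less_Suc_eq_le chain_sum_def)
  ultimately show ?R by blast
next
  assume ?R
  then obtain a b :: "nat \<Rightarrow> 'a"
    where a: "strict_mono_on {..r} a" and b: "strict_mono_on {..s} b"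
      and ab: "\<not> a 0 \<le> b s" and ba: "\<not> b 0 \<le> a r"
    by blast
  have a_le: "a i \<le> a j \<longleftrightarrow> i \<le> j" if "i \<le> r" "j \<le> r" for i j
    using strict_mono_on_less_eq[OF a] that by simp
  have b_le: "b i \<le> b j \<longleftrightarrow> i \<le> j" if "i \<le> s" "j \<le> s" for i j
    using strict_mono_on_less_eq[OF b] that by simp
  have ab': "\<not> a i \<le> b j" and ba': "\<not> b j \<le> a i" if "i \<le> r" "j \<le> s" for i j
    using that ab ba a_le[of 0 i] a_le[of i r] b_le[of 0 j] b_le[of j s]
    by (auto dest: order_trans)
  let ?f = "case_sum a b"
  have f: "?f x \<le> ?f y \<longleftrightarrow> (x, y) \<in> chain_sum (Suc r) (Suc s)"
    if "x \<in> {..<Suc r} <+> {..<Suc s}" "y \<in> {..<Suc r} <+> {..<Suc s}" for x y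
    using that by (auto simp: chain_sum_def a_le b_le ab' ba')
  have "inj_on ?f ({..<Suc r} <+> {..<Suc s})"
  proof (rule inj_onI)
    fix x y
    assume xy: "x \<in> {..<Suc r} <+> {..<Suc s}" "y \<in> {..<Suc r} <+> {..<Suc s}" "?f x = ?f y"
    then have "(x, y) \<in> chain_sum (Suc r) (Suc s)" "(y, x) \<in> chain_sum (Suc r) (Suc s)"
      using f[of x y] f[of y x] by auto
    then show "x = y" by (auto simp: chain_sum_def)
  qed
  with f show ?L
    unfolding embeds_poset_def Field_chain_sum by blast
qed

text \<open>
  The right-hand side depends on \<open>r\<close> and \<open>s\<close> only through \<open>r + s\<close>: the chain of differences
  from \<open>a\<^sub>0 - b\<^sub>s\<close> to \<open>a\<^sub>r - b\<^sub>0\<close> may be cut into its \<open>b\<close>-part and its \<open>a\<close>-part at any place.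
\<close>

lemma embeds_chain_sum_iff_chain:
  "embeds_poset TYPE('a::ordered_group_add) (chain_sum (Suc r) (Suc s)) \<longleftrightarrow>
    (\<exists>y :: nat \<Rightarrow> 'a. strict_mono_on {..r + s} y \<and> \<not> y 0 \<le> 0 \<and> \<not> 0 \<le> y (r + s))"
    (is "_ \<longleftrightarrow> ?R")
  unfolding embeds_chain_sum_iff_extremes
proof
  assume "\<exists>a b :: nat \<Rightarrow> 'a. strict_mono_on {..r} a \<and> strict_mono_on {..s} b \<and>
            \<not> a 0 \<le> b s \<and> \<not> b 0 \<le> a r"
  then obtain a b :: "nat \<Rightarrow> 'a"
    where a: "strict_mono_on {..r} a" and b: "strict_mono_on {..s} b"
      and ab: "\<not> a 0 \<le> b s" and ba: "\<not> b 0 \<le> a r"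
    by blast
  \<comment> \<open>Truncated subtraction lets one formula cover both halves: up to \<open>s\<close> only the subtrahend
     moves, from \<open>s\<close> on only the minuend.\<close>
  define y where "y k = a (k - s) - b (s - k)" for k
  have lower: "y i < y j" if "i < j" "j \<le> s" for i j
    using that strict_mono_onD[OF b, of "s - j" "s - i"]
    by (simp add: y_def group_diff_strict_left_antimono)
  have upper: "y i < y j" if "i < j" "s \<le> i" "j \<le> r + s" for i j
    using that strict_mono_onD[OF a, of "i - s" "j - s"]
    by (simp add: y_def group_diff_strict_right_mono less_diff_iff le_diff_conv)
  have "y i < y j" if "i < j" "j \<le> r + s" for i j
  proof -
    consider "j \<le> s" | "s \<le> i" | "i < s" "s < j" by linarith
    then show ?thesis
      using lower upper that by cases (auto intro: less_trans[of _ "y s"])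
  qed
  then have "strict_mono_on {..r + s} y"
    by (auto intro: strict_mono_onI)
  moreover have "\<not> y 0 \<le> 0" "\<not> 0 \<le> y (r + s)"
    using ab ba by (simp_all add: y_def group_diff_le_0_iff group_0_le_diff_iff)
  ultimately show ?R by blast
next
  assume ?R
  then obtain y :: "nat \<Rightarrow> 'a"
    where y: "strict_mono_on {..r + s} y" and y0: "\<not> y 0 \<le> 0" and yn: "\<not> 0 \<le> y (r + s)"
    by blast
  define a where "a i = y (s + i)" for i
  \<comment> \<open>The solution of \<open>y (s - j) = a 0 - b j\<close>; in particular \<open>b 0 = 0\<close>.\<close>
  define b where "b j = - y (s - j) + y s" for j
  have "strict_mono_on {..r} a"
    by (auto intro!: strict_mono_onI strict_mono_onD[OF y] simp: a_def)
  moreover have "strict_mono_on {..s} b"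
    unfolding b_def
    by (intro strict_mono_onI group_add_strict_right_mono group_minus_strict_antimono
        strict_mono_onD[OF y]) auto
  moreover have "a 0 - b s = y 0"
    by (simp add: a_def b_def diff_conv_add_uminus minus_add add.assoc [symmetric]
        del: add_uminus_conv_diff)
  then have "\<not> a 0 \<le> b s"
    using y0 group_diff_le_0_iff[of "a 0" "b s"] by simp
  moreover have "\<not> b 0 \<le> a r"
    using yn by (simp add: a_def b_def add.commute)
  ultimately show "\<exists>a b :: nat \<Rightarrow> 'a. strict_mono_on {..r} a \<and> strict_mono_on {..s} b \<and>
            \<not> a 0 \<le> b s \<and> \<not> b 0 \<le> a r"
    by blast
qed

theorem theorem4:
  fixes n p q :: nat
  assumes "n \<ge> 2" and "p > 0" and "q > 0" and "n = p + q"
  shows "embeds_poset TYPE('a::ordered_group_add) (chain_sum 1 n) \<longleftrightarrow>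
         embeds_poset TYPE('a) (chain_sum (q + 1) p)"
proof -
  obtain p' where p: "p = Suc p'"
    using assms(2) gr0_implies_Suc by blast
  have n: "n = Suc (q + p')"
    using assms(4) p by simp
  show ?thesis
    using embeds_chain_sum_iff_chain[of 0 "q + p'", where ?'a = 'a]
      embeds_chain_sum_iff_chain[of q p', where ?'a = 'a]
    unfolding n p by simp
qed

end
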